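(* Let $1\le k\le N-1$ and let $v\in V$, $v\neq 0$, be such that its Rayleigh quotient $\lambda=\lambda(v)$ satisfies $\lambda_k\le\lambda<\lambda_{k+1}$. Let $\xi\in V$ be a perturbation satisfying $$\frac{\|\xi\|_A}{\|v\|_A}\le\gamma_\xi\,\rho(v),\qquad\text{where}\quad \gamma:=\gamma_P+\gamma_\xi<1 .$$ Let $v'$ be the result of one step of the perturbed preconditioned inverse iteration started at $v$, i.e. $$\tilde v'=v-P^{-1}\bigl(Av-\lambda(v)Ev\bigr)+\xi,\qquad v'=|\tilde v'|^{-1}\tilde v',$$ and let $\lambda'=\lambda(v')$. Then either $\lambda'<\lambda_k$ or $\lambda_k\le\lambda'<\lambda_{k+1}$. In the latter case $$\frac{\lambda'-\lambda_k}{\lambda_{k+1}-\lambda'}\le q^2(\gamma,\lambda_k,\lambda_{k+1})\,\frac{\lambda-\lambda_k}{\lambda_{k+1}-\lambda},\qquad q(\gamma,\lambda_k,\lambda_{k+1})=1-(1-\gamma)\Bigl(1-\frac{\lambda_k}{\lambda_{k+1}}\Bigr).$$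
   Context: Setting. $(H,(\cdot,\cdot),|\cdot|)$ is a separable real Hilbert space and $(V,\|\cdot\|)$ a reflexive separable real Banach space, $V\subset H$ dense and continuously embedded. $V\subset H\cong H^*\subset V^*$ is the Gelfand triple, with dual pairing $\langle\cdot,\cdot\rangle:V^*\times V\to\mathbb R$. $A:V\to V^*$ is linear, bounded, symmetric ($\langle Av,u\rangle=\langle Au,v\rangle$) and strongly positive ($\langle Av,v\rangle\ge\sigma_0\|v\|^2$ with $\sigma_0>0$). $E:H\to H^*$, $v\mapsto(\cdot,v)$, and its restriction $V\to V^*$ is also denoted $E$. Norms: $\|v\|_A=\langle Av,v\rangle^{1/2}$ for $v\in V$; $\|f\|_{A^{-1}}=\langle f,A^{-1}f\rangle^{1/2}$ for $f\in V^*$. For linear operators on $V$, $\|\cdot\|_A$ is also the operator norm induced by $\|\cdot\|_A$. Spectrum: $\lambda\in\mathbb R$ is an eigenvalue if $Av=\lambda Ev$ for some $v\in V\setminus\{0\}$ (an eigenvector). The resolvent set consists of those $\lambda\in\mathbb R$ for which $Av-\lambda Ev=f$ is uniquely solvable for all $f\in H^*$ with inverse mapping in $\mathcal L(H^*,V)$; the spectrum is its complement in $\mathbb R$. It is assumed that the lower part of the spectrum consists of eigenvalues $0<\lambda_1<\dots<\lambda_N$ with finite-dimensional eigenspaces $\mathcal E_1,\dots,\mathcal E_N$, and that the rest of the spectrum is bounded from below by some $\Lambda>\lambda_N$ and is unbounded from above. Rayleigh quotient: $\lambda(v)=\langle Av,v\rangle/\langle Ev,v\rangle=\langle Av,v\rangle/(v,v)$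 for $v\in V\setminus\{0\}$. Residual: $\rho(v)=\|Av-\lambda(v)Ev\|_{A^{-1}}/\|v\|_A$. Preconditioner: $P:V\to V^*$ is a symmetric operator, spectrally equivalent to $A$, with $\|\mathrm{Id}-P^{-1}A\|_A\le\gamma_P$ for some constant $\gamma_P<1$. The constant $\gamma_\xi$ is nonnegative. *)

theory Defs
  imports "HOL-Analysis.Analysis"
begin

(* The inclusion of V into H is an injective bounded linear map emb; an element v of V, seen
   in H, is emb v.  Dual spaces are the spaces of bounded linear functionals, and the pairing
   of f in V* with v in V is the application f v. *)

definition reflexive_space :: "'v::banach itself \<Rightarrow> bool" where
  "reflexive_space _ \<longleftrightarrow>
     (\<forall>F :: ('v \<Rightarrow>\<^sub>L real) \<Rightarrow>\<^sub>L real. \<exists>v. \<forall>f. blinfun_apply F f = blinfun_apply f v)"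

definition gelfand_triple ::
  "('v::banach \<Rightarrow>\<^sub>L 'h::{real_inner,complete_space}) \<Rightarrow> bool" where
  "gelfand_triple emb \<longleftrightarrow>
     separable_space (euclidean :: 'h topology) \<and>
     separable_space (euclidean :: 'v topology) \<and>
     reflexive_space TYPE('v) \<and>
     inj (blinfun_apply emb) \<and>
     closure (range (blinfun_apply emb)) = UNIV"

definition symmetric_op :: "('v::banach \<Rightarrow>\<^sub>L ('v \<Rightarrow>\<^sub>L real)) \<Rightarrow> bool" where
  "symmetric_op B \<longleftrightarrow> (\<forall>u v. B v u = B u v)"

definition strongly_positive :: "('v::banach \<Rightarrow>\<^sub>L ('v \<Rightarrow>\<^sub>L real)) \<Rightarrow> bool" where
  "strongly_positive B \<longleftrightarrow> (\<exists>\<sigma>\<^sub>0>0. \<forall>v. \<sigma>\<^sub>0 * (norm v)\<^sup>2 \<le> B v v)"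

definition spectrally_equivalent ::
  "('v::banach \<Rightarrow>\<^sub>L ('v \<Rightarrow>\<^sub>L real)) \<Rightarrow> ('v \<Rightarrow>\<^sub>L ('v \<Rightarrow>\<^sub>L real)) \<Rightarrow> bool" where
  "spectrally_equivalent P A \<longleftrightarrow>
     (\<exists>c>0. \<exists>C>0. \<forall>v. c * A v v \<le> P v v \<and> P v v \<le> C * A v v)"

definition E_op ::
  "('v::banach \<Rightarrow>\<^sub>L 'h::{real_inner,complete_space}) \<Rightarrow> 'v \<Rightarrow> ('v \<Rightarrow>\<^sub>L real)" where
  "E_op emb v = blinfun_inner_left (emb v) o\<^sub>L emb"

definition norm_A :: "('v::banach \<Rightarrow>\<^sub>L ('v \<Rightarrow>\<^sub>L real)) \<Rightarrow> 'v \<Rightarrow> real" where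
  "norm_A A v = sqrt (A v v)"

(* For strongly positive A the map A is a bijection from V onto V* (Lax-Milgram), so inv is
   its actual inverse. The same applies to the inverse of P below. *)
definition norm_Ainv :: "('v::banach \<Rightarrow>\<^sub>L ('v \<Rightarrow>\<^sub>L real)) \<Rightarrow> ('v \<Rightarrow>\<^sub>L real) \<Rightarrow> real" where
  "norm_Ainv A f = sqrt (f (inv (blinfun_apply A) f))"

(* Same shape as onorm: the quotient is 0 at v = 0. It is meant for operators that are bounded
   in norm_A, for which the supremum is that of a set bounded above. *)
definition op_norm_A :: "('v::banach \<Rightarrow>\<^sub>L ('v \<Rightarrow>\<^sub>L real)) \<Rightarrow> ('v \<Rightarrow> 'v) \<Rightarrow> real" where
  "op_norm_A A T = (SUP v. norm_A A (T v) / norm_A A v)"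

definition eigenspace ::
  "('v::banach \<Rightarrow>\<^sub>L 'h::{real_inner,complete_space}) \<Rightarrow> ('v \<Rightarrow>\<^sub>L ('v \<Rightarrow>\<^sub>L real)) \<Rightarrow> real \<Rightarrow> 'v set" where
  "eigenspace emb A \<mu> = {v. A v = \<mu> *\<^sub>R E_op emb v}"

definition is_eigenvalue ::
  "('v::banach \<Rightarrow>\<^sub>L 'h::{real_inner,complete_space}) \<Rightarrow> ('v \<Rightarrow>\<^sub>L ('v \<Rightarrow>\<^sub>L real)) \<Rightarrow> real \<Rightarrow> bool" where
  "is_eigenvalue emb A \<mu> \<longleftrightarrow> (\<exists>v. v \<noteq> 0 \<and> A v = \<mu> *\<^sub>R E_op emb v)"

(* A functional f in H* acts on V through its restriction f o emb. R is the bounded solution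
   operator: for every f, the equation has the unique solution R f. *)
definition resolvent_set ::
  "('v::banach \<Rightarrow>\<^sub>L 'h::{real_inner,complete_space}) \<Rightarrow> ('v \<Rightarrow>\<^sub>L ('v \<Rightarrow>\<^sub>L real)) \<Rightarrow> real set" where
  "resolvent_set emb A =
     {\<mu>. \<exists>R :: ('h \<Rightarrow>\<^sub>L real) \<Rightarrow>\<^sub>L 'v.
        \<forall>f v. A v - \<mu> *\<^sub>R E_op emb v = f o\<^sub>L emb \<longleftrightarrow> v = R f}"

definition op_spectrum ::
  "('v::banach \<Rightarrow>\<^sub>L 'h::{real_inner,complete_space}) \<Rightarrow> ('v \<Rightarrow>\<^sub>L ('v \<Rightarrow>\<^sub>L real)) \<Rightarrow> real set" where
  "op_spectrum emb A = - resolvent_set emb A"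

(* The eigenvalues are lam 1 < ... < lam N; values of lam outside {1..N} are irrelevant. *)
definition discrete_lower_spectrum ::
  "('v::banach \<Rightarrow>\<^sub>L 'h::{real_inner,complete_space}) \<Rightarrow> ('v \<Rightarrow>\<^sub>L ('v \<Rightarrow>\<^sub>L real))
     \<Rightarrow> nat \<Rightarrow> (nat \<Rightarrow> real) \<Rightarrow> real \<Rightarrow> bool" where
  "discrete_lower_spectrum emb A N lam \<Lambda> \<longleftrightarrow>
     N \<ge> 1 \<and> 0 < lam 1 \<and> strict_mono_on {1..N} lam \<and>
     (\<forall>j\<in>{1..N}. is_eigenvalue emb A (lam j) \<and>
        (\<exists>B. finite B \<and> eigenspace emb A (lam j) = span B)) \<and>
     lam N < \<Lambda> \<and>
     (\<forall>\<mu>\<in>op_spectrum emb A - lam ` {1..N}. \<Lambda> \<le> \<mu>) \<and>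
     \<not> bdd_above (op_spectrum emb A - lam ` {1..N})"

definition rayleigh ::
  "('v::banach \<Rightarrow>\<^sub>L 'h::{real_inner,complete_space}) \<Rightarrow> ('v \<Rightarrow>\<^sub>L ('v \<Rightarrow>\<^sub>L real)) \<Rightarrow> 'v \<Rightarrow> real" where
  "rayleigh emb A v = A v v / E_op emb v v"

definition residual ::
  "('v::banach \<Rightarrow>\<^sub>L 'h::{real_inner,complete_space}) \<Rightarrow> ('v \<Rightarrow>\<^sub>L ('v \<Rightarrow>\<^sub>L real)) \<Rightarrow> 'v \<Rightarrow> real" where
  "residual emb A v =
     norm_Ainv A (A v - rayleigh emb A v *\<^sub>R E_op emb v) / norm_A A v"

definition pinvit_update ::
  "('v::banach \<Rightarrow>\<^sub>L 'h::{real_inner,complete_space}) \<Rightarrow> ('v \<Rightarrow>\<^sub>L ('v \<Rightarrow>\<^sub>L real))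
     \<Rightarrow> ('v \<Rightarrow>\<^sub>L ('v \<Rightarrow>\<^sub>L real)) \<Rightarrow> 'v \<Rightarrow> 'v \<Rightarrow> 'v" where
  "pinvit_update emb A P \<xi> v =
     v - inv (blinfun_apply P) (A v - rayleigh emb A v *\<^sub>R E_op emb v) + \<xi>"

definition pinvit_step ::
  "('v::banach \<Rightarrow>\<^sub>L 'h::{real_inner,complete_space}) \<Rightarrow> ('v \<Rightarrow>\<^sub>L ('v \<Rightarrow>\<^sub>L real))
     \<Rightarrow> ('v \<Rightarrow>\<^sub>L ('v \<Rightarrow>\<^sub>L real)) \<Rightarrow> 'v \<Rightarrow> 'v \<Rightarrow> 'v" where
  "pinvit_step emb A P \<xi> v =
     (let w = pinvit_update emb A P \<xi> v in inverse (norm (emb w)) *\<^sub>R w)"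

definition conv_factor :: "real \<Rightarrow> real \<Rightarrow> real \<Rightarrow> real" where
  "conv_factor \<gamma> a b = 1 - (1 - \<gamma>) * (1 - a / b)"

end

theory Submission
  imports Defs
begin

text \<open>
  Put \<open>T = A\<inverse> E\<close>. In the energy inner product \<open>(u,w) = \<langle>Au,w\<rangle>\<close> this is a bounded, symmetric,
  positive operator on \<open>V\<close>; its Rayleigh quotient is the reciprocal of \<open>\<lambda>(v)\<close>, and the eigenvalues
  \<open>\<lambda>\<^sub>k < \<lambda>\<^sub>k\<^sub>+\<^sub>1\<close> become \<open>\<alpha> = 1/\<lambda>\<^sub>k > \<beta> = 1/\<lambda>\<^sub>k\<^sub>+\<^sub>1\<close>. With \<open>\<mu> = 1/\<lambda>(v)\<close> the hypotheses on the
  preconditioner and on the perturbation together imply that \<open>\<mu>\<close> times the new iterate before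
  normalisation is a vector \<open>y\<close> of the ball
  \<open>\<parallel>y - T v\<parallel> \<le> \<gamma> \<parallel>T v - \<mu> v\<parallel>\<close> of the energy norm (\<open>pinvit_update_distance\<close>). Because the Rayleigh
  quotient ignores scaling, it remains to bound the Rayleigh quotient of \<open>T\<close> from below on this
  ball, by the number \<open>c\<close> with \<open>(\<alpha> - c)/(c - \<beta>) = \<sigma>\<^sup>2 (\<alpha> - \<mu>)/(\<mu> - \<beta>)\<close>, where
  \<open>\<sigma> = \<gamma> + (1 - \<gamma>) \<beta>/\<alpha>\<close> is the convergence factor.

  The spectrum enters only through \<open>(T - \<alpha>)(T - \<beta>) \<ge> 0\<close>, the operator form of the absence of
  spectrum between \<open>\<beta>\<close> and \<open>\<alpha>\<close> (\<open>psd_form.gap_nonneg\<close>, \<open>spectral_gap\<close>). It is needed both in the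
  energy inner product and in that of \<open>H\<close>; the latter is \<open>(T\<cdot>,\<cdot>)\<close>, so that it yields the positivity
  of the product \<open>T (T - \<alpha>)(T - \<beta>)\<close> without a functional calculus.

  The bound on the ball is a quadratic inequality under one quadratic constraint, hence a matter of
  finding a Lagrange multiplier \<open>\<tau>\<close> with
  \<open>((T - c) y, y) + \<tau> (\<parallel>y - T x\<parallel>\<^sup>2 - G \<parallel>T x - \<mu> x\<parallel>\<^sup>2) \<ge> 0\<close> for all \<open>y\<close>, with some \<open>G \<ge> \<gamma>\<^sup>2\<close>. Let
  \<open>\<tau> = c + s\<close>. The minimum over \<open>y\<close> is found by completing the square with \<open>T + s\<close>; writing
  \<open>x = (T + s) z\<close>, and using \<open>((T - \<mu>) x, x) = 0\<close>, its nonnegativity becomes \<open>(F(T) z, (T + s) z) \<ge> 0\<close>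
  for the cubic \<open>F(t) = (t - c) t\<^sup>2 - G (t - \<mu>)(t + s)\<^sup>2\<close>. In the plane spanned by eigenvectors for
  \<open>\<alpha>\<close> and \<open>\<beta>\<close>, the extremal vector is \<open>\<tau> (T + s)\<inverse> T x\<close>, and its tangent is \<open>\<sigma>\<close> times that
  of \<open>x\<close> exactly for \<open>s = \<beta> (1 - \<gamma>)/\<gamma>\<close>; the radius for which it lies on the sphere corresponds to
  \<open>G = \<gamma>\<^sup>2 (c - \<beta>)/(\<mu> - \<beta>)\<close>. For these values
  \<open>F(t) = (t - \<alpha>)(t - \<beta>)((1 - G) t + \<delta>)\<close> with \<open>G \<le> 1\<close> and \<open>\<delta> \<ge> 0\<close> (\<open>cubic_factorisation\<close>), and the
  gap inequalities finish the proof (\<open>ratio_contraction\<close>). The choice of \<open>s\<close> requires \<open>\<gamma> > 0\<close>;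
  the case \<open>\<gamma> = 0\<close> follows by letting the parameter decrease to it.
\<close>

section \<open>Positive semidefinite forms\<close>

text \<open>
  The argument uses the energy form and the inner product of \<open>H\<close> on the same vector space \<open>V\<close>, and
  in between a form that may degenerate. They are therefore treated as explicit functions
  rather than as instances of an inner product class.
\<close>

locale psd_form =
  fixes g :: "'v::real_vector \<Rightarrow> 'v \<Rightarrow> real"
  assumes bilin: "bilinear g"
    and sym: "g x y = g y x"
    and nonneg: "0 \<le> g x x"
begin

lemmas expand =
  bilinear_ladd[OF bilin] bilinear_radd[OF bilin] bilinear_lsub[OF bilin] bilinear_rsub[OF bilin]
  bilinear_lmul[OF bilin] bilinear_rmul[OF bilin] bilinear_lneg[OF bilin] bilinear_rneg[OF bilin]
  bilinear_lzero[OF bilin] bilinear_rzero[OF bilin]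

lemma cauchy_schwarz: "(g x y)\<^sup>2 \<le> g x x * g y y"
proof -
  have quad: "0 \<le> g x x + 2 * t * g x y + t\<^sup>2 * g y y" for t
    using nonneg[of "x + t *\<^sub>R y"] sym[of y x]
    by (simp add: expand algebra_simps power2_eq_square)
  show ?thesis
  proof (cases "g y y = 0")
    case True
    have "g x y = 0"
    proof (rule ccontr)
      assume "g x y \<noteq> 0"
      with quad[of "- (g x x + 1) / (2 * g x y)"] True show False
        by (simp add: field_simps)
    qed
    with True show ?thesis by simp
  next
    case False
    with nonneg[of y] have pos: "0 < g y y" by simp
    have "0 \<le> g x x - (g x y)\<^sup>2 / g y y"
      using quad[of "- g x y / g y y"] pos by (simp add: field_simps power2_eq_square)
    with pos show ?thesis by (simp add: field_simps)
  qed
qed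

lemma triangle: "sqrt (g (x + y) (x + y)) \<le> sqrt (g x x) + sqrt (g y y)"
proof (rule real_le_lsqrt)
  have "g x y \<le> sqrt (g x x * g y y)"
    using cauchy_schwarz[of x y] by (rule real_le_rsqrt)
  then show "g (x + y) (x + y) \<le> (sqrt (g x x) + sqrt (g y y))\<^sup>2"
    using nonneg[of x] nonneg[of y] sym[of y x]
    by (simp add: expand power2_sum real_sqrt_mult)
qed (simp add: nonneg)

text \<open>
  A spectral gap of a symmetric operator, stated as a quadratic inequality. Let \<open>m\<close> be the midpoint
  and \<open>r\<close> half the length of the gap, and \<open>D = S - m\<close>; the claim is \<open>D\<^sup>2 \<ge> r\<^sup>2\<close>. The infimum \<open>\<rho>\<close> of the
  Rayleigh quotient of \<open>D\<^sup>2\<close> is an approximate eigenvalue, because Cauchy-Schwarz for the semidefinite form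
  of \<open>D\<^sup>2 - \<rho>\<close> bounds \<open>\<parallel>(D\<^sup>2 - \<rho>) y\<parallel>\<^sup>2\<close> by a multiple of \<open>((D\<^sup>2 - \<rho>) y, y)\<close>. If \<open>\<rho> < r\<^sup>2\<close>, then
  \<open>D\<^sup>2 - \<rho> = (D - \<surd>\<rho>)(D + \<surd>\<rho>)\<close> is a product of two operators that are bounded below, since
  \<open>m \<plusminus> \<surd>\<rho>\<close> both lie in the gap; this is a contradiction.
\<close>

lemma gap_nonneg:
  assumes lin: "linear S"
    and S_sym: "\<And>x y. g (S x) y = g x (S y)"
    and S_bound: "\<And>x. g (S x) (S x) \<le> M * g x x"
    and resolvent: "\<And>m. b < m \<Longrightarrow> m < a \<Longrightarrow>
       \<exists>d>0. \<forall>x. d * g x x \<le> g (S x - m *\<^sub>R x) (S x - m *\<^sub>R x)"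
    and "b < a"
  shows "0 \<le> g (S x) (S x) - (a + b) * g (S x) x + a * b * g x x"
proof (rule ccontr)
  assume neg: "\<not> ?thesis"
  define m where "m = (a + b) / 2"
  define r where "r = (a - b) / 2"
  define D where "D y = S y - m *\<^sub>R y" for y
  have S_add: "S (y + z) = S y + S z" and S_scale: "S (t *\<^sub>R y) = t *\<^sub>R S y"
    and S_diff: "S (y - z) = S y - S z" for y z t
    using lin by (simp_all add: linear_add linear_scale linear_diff)
  have r_pos: "0 < r" using \<open>b < a\<close> by (simp add: r_def)
  have D_sym: "g (D y) z = g y (D z)" for y z
    by (simp add: D_def expand S_sym)
  have x_low: "g (D x) (D x) < r\<^sup>2 * g x x"
    using neg sym[of x "S x"]
    by (simp add: D_def r_def m_def expand field_simps power2_eq_square)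
  have x_pos: "0 < g x x"
    using x_low nonneg[of "D x"] r_pos
    by (smt (verit) nonneg mult_eq_0_iff)
  define Q where "Q = {g (D y) (D y) / g y y | y. 0 < g y y}"
  define \<rho> where "\<rho> = Inf Q"
  have Q_bdd: "bdd_below Q"
    by (rule bdd_belowI[of _ 0]) (auto simp: Q_def nonneg)
  have Q_mem: "0 < g y y \<Longrightarrow> g (D y) (D y) / g y y \<in> Q" for y
    by (auto simp: Q_def)
  have Q_ne: "Q \<noteq> {}" using Q_mem[OF x_pos] by blast
  have \<rho>_nonneg: "0 \<le> \<rho>"
    unfolding \<rho>_def by (rule cInf_greatest[OF Q_ne]) (auto simp: Q_def nonneg)
  have "\<rho> \<le> g (D x) (D x) / g x x"
    unfolding \<rho>_def by (rule cInf_lower[OF Q_mem[OF x_pos] Q_bdd])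
  also have "\<dots> < r\<^sup>2" using x_low x_pos by (simp add: field_simps)
  finally have \<rho>_less: "\<rho> < r\<^sup>2" .
  define r0 where "r0 = sqrt \<rho>"
  have r0: "0 \<le> r0" "r0 < r" "r0\<^sup>2 = \<rho>"
    using \<rho>_nonneg \<rho>_less r_pos by (auto simp: r0_def intro: real_less_lsqrt)
  have \<rho>_low: "\<rho> * g y y \<le> g (D y) (D y)" for y
  proof (cases "0 < g y y")
    case True
    have "\<rho> \<le> g (D y) (D y) / g y y"
      unfolding \<rho>_def by (rule cInf_lower[OF Q_mem[OF True] Q_bdd])
    with True show ?thesis by (simp add: field_simps)
  next
    case False
    with nonneg[of y] have "g y y = 0" by simp
    then show ?thesis by (simp add: nonneg)
  qed
  define B where "B y z = g (D y) (D z) - \<rho> * g y z" for y z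
  have B_psd: "psd_form B"
  proof
    show "bilinear B"
      by (auto simp: bilinear_def B_def D_def expand S_add S_scale algebra_simps intro!: linearI)
    show "B y z = B z y" for y z by (simp add: B_def sym)
    show "0 \<le> B y y" for y using \<rho>_low[of y] by (simp add: B_def)
  qed
  define C where "C y = D (D y) - \<rho> *\<^sub>R y" for y
  have B_C: "B y z = g (C y) z" for y z
    by (simp add: B_def C_def expand D_sym)
  define M' where "M' = 2 * \<bar>M\<bar> + 2 * m\<^sup>2 + 1"
  have M'_pos: "0 < M'" by (simp add: M'_def add_nonneg_pos)
  have B_bound: "B y y \<le> M' * g y y" for y
  proof -
    have "g (D y) (D y) \<le> 2 * g (S y) (S y) + 2 * m\<^sup>2 * g y y"
      using nonneg[of "S y + m *\<^sub>R y"] by (simp add: D_def expand algebra_simps power2_eq_square)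
    also have "\<dots> \<le> 2 * (\<bar>M\<bar> * g y y) + 2 * m\<^sup>2 * g y y"
      using S_bound[of y] nonneg[of y] mult_right_mono[of M "\<bar>M\<bar>" "g y y"] by linarith
    also have "\<dots> \<le> M' * g y y" using nonneg[of y] by (simp add: M'_def algebra_simps)
    finally show ?thesis
      using \<rho>_nonneg nonneg[of y] by (simp add: B_def) (smt (verit) mult_nonneg_nonneg)
  qed
  have C_bound: "g (C y) (C y) \<le> M' * B y y" for y
  proof (cases "g (C y) (C y) = 0")
    case True
    then show ?thesis using psd_form.nonneg[OF B_psd, of y] M'_pos by simp
  next
    case False
    with nonneg[of "C y"] have pos: "0 < g (C y) (C y)" by simp
    have "(g (C y) (C y))\<^sup>2 \<le> B y y * B (C y) (C y)"
      using psd_form.cauchy_schwarz[OF B_psd, of y "C y"] by (simp add: B_C)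
    also have "\<dots> \<le> B y y * (M' * g (C y) (C y))"
      using B_bound psd_form.nonneg[OF B_psd, of y] by (rule mult_left_mono)
    finally have "g (C y) (C y) * g (C y) (C y) \<le> (M' * B y y) * g (C y) (C y)"
      by (simp add: power2_eq_square mult_ac)
    with pos show ?thesis by (simp only: mult_le_cancel_right_pos)
  qed
  obtain d1 where d1: "0 < d1" "\<And>y. d1 * g y y \<le> g (S y - (m + r0) *\<^sub>R y) (S y - (m + r0) *\<^sub>R y)"
    using resolvent[of "m + r0"] r0 by (auto simp: m_def r_def field_simps)
  obtain d2 where d2: "0 < d2" "\<And>y. d2 * g y y \<le> g (S y - (m - r0) *\<^sub>R y) (S y - (m - r0) *\<^sub>R y)"
    using resolvent[of "m - r0"] r0 by (auto simp: m_def r_def field_simps)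
  have C_factor: "C y = S w - (m + r0) *\<^sub>R w" if "w = S y - (m - r0) *\<^sub>R y" for y w
    unfolding C_def D_def that r0(3)[symmetric]
    by (simp add: S_add S_diff S_scale algebra_simps power2_eq_square)
  have C_low: "d1 * d2 * g y y \<le> g (C y) (C y)" for y
  proof -
    define w where "w = S y - (m - r0) *\<^sub>R y"
    have "d1 * (d2 * g y y) \<le> d1 * g w w"
      unfolding w_def using d1(1) d2(2) by (simp add: mult_left_mono)
    also have "\<dots> \<le> g (C y) (C y)" using d1(2)[of w] C_factor[OF w_def] by simp
    finally show ?thesis by (simp add: mult.assoc)
  qed
  \<comment> \<open>The lower and the upper bound for \<open>C\<close> push the Rayleigh quotient of \<open>D\<^sup>2\<close> away from its infimum.\<close>
  have "\<rho> + d1 * d2 / M' \<le> \<rho>"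
    unfolding \<rho>_def
  proof (rule cInf_greatest[OF Q_ne])
    fix q assume "q \<in> Q"
    then obtain y where y: "0 < g y y" "q = g (D y) (D y) / g y y" by (auto simp: Q_def)
    have "d1 * d2 * g y y \<le> M' * (g (D y) (D y) - \<rho> * g y y)"
      using C_low[of y] C_bound[of y] by (simp add: B_def)
    with y(1) M'_pos show "Inf Q + d1 * d2 / M' \<le> q"
      unfolding y(2) \<rho>_def[symmetric] by (simp add: field_simps)
  qed
  moreover have "0 < d1 * d2 / M'" using d1(1) d2(1) M'_pos by simp
  ultimately show False by linarith
qed

end

section \<open>Solvability of symmetric coercive problems\<close>

text \<open>
  Surjectivity is the Dirichlet principle: the energy \<open>J v = B v v - 2 f v\<close> is bounded below, and by the
  parallelogram law its minimising sequences are Cauchy. At the limit \<open>u\<close> the first variation vanishes,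
  which is \<open>B u = f\<close>.
\<close>

lemma bij_of_strongly_positive:
  fixes B :: "'v::banach \<Rightarrow>\<^sub>L ('v \<Rightarrow>\<^sub>L real)"
  assumes "symmetric_op B" "strongly_positive B"
  shows "bij (blinfun_apply B)"
proof -
  obtain \<sigma> where \<sigma>: "0 < \<sigma>" and coercive: "\<And>v. \<sigma> * (norm v)\<^sup>2 \<le> B v v"
    using assms(2) by (auto simp: strongly_positive_def)
  have B_sym: "B u v = B v u" for u v using assms(1) by (auto simp: symmetric_op_def)
  note B_simps = blinfun.add_left blinfun.add_right blinfun.diff_left blinfun.diff_right
    blinfun.scaleR_left blinfun.scaleR_right
  have "inj (blinfun_apply B)"
  proof (rule injI)
    fix u v assume "B u = B v"
    then have "B (u - v) (u - v) = 0" by (simp add: B_simps)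
    with coercive[of "u - v"] \<sigma> show "u = v"
      by (simp add: mult_le_0_iff)
  qed
  moreover have "\<exists>u. B u = f" for f
  proof -
    define J where "J v = B v v - 2 * f v" for v
    have J_low: "- ((norm f)\<^sup>2 / \<sigma>) \<le> J v" for v
    proof -
      have "f v \<le> norm f * norm v" using norm_blinfun[of f v] by simp
      then have "\<sigma> * (norm v)\<^sup>2 - 2 * (norm f * norm v) \<le> J v"
        using coercive[of v] by (simp add: J_def)
      then have "\<sigma> * (\<sigma> * (norm v)\<^sup>2 - 2 * (norm f * norm v)) \<le> \<sigma> * J v"
        using \<sigma> by (intro mult_left_mono) auto
      moreover have "0 \<le> (\<sigma> * norm v - norm f)\<^sup>2" by simp
      ultimately have "- (norm f)\<^sup>2 \<le> \<sigma> * J v"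
        by (simp add: power2_eq_square algebra_simps)
      with \<sigma> show ?thesis by (simp add: field_simps)
    qed
    define d where "d = Inf (range J)"
    have J_bdd: "bdd_below (range J)" by (rule bdd_belowI2) (rule J_low)
    have d_le: "d \<le> J v" for v unfolding d_def by (rule cInf_lower[OF _ J_bdd]) simp
    have "\<exists>v. J v < d + inverse (real (Suc n))" for n
      using cInf_lessD[of "range J" "d + inverse (real (Suc n))"] by (auto simp: d_def)
    then obtain w where w: "\<And>n. J (w n) < d + inverse (real (Suc n))" by metis
    have par: "\<sigma> * (norm (u - v))\<^sup>2 \<le> 2 * (J u - d) + 2 * (J v - d)" for u v
    proof -
      define mid where "mid = (1/2) *\<^sub>R (u + v)"
      have "B (u - v) (u - v) = 2 * J u + 2 * J v - 4 * J mid"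
        by (simp add: J_def mid_def B_simps B_sym[of v u] algebra_simps)
      with coercive[of "u - v"] have "\<sigma> * (norm (u - v))\<^sup>2 \<le> 2 * J u + 2 * J v - 4 * J mid"
        by (rule order.trans[OF _ eq_refl])
      also have "\<dots> \<le> 2 * (J u - d) + 2 * (J v - d)" using d_le[of mid] by (simp add: algebra_simps)
      finally show ?thesis .
    qed
    have "Cauchy w"
    proof (rule metric_CauchyI)
      fix \<epsilon> :: real assume \<epsilon>: "0 < \<epsilon>"
      obtain n0 where n0: "inverse (real (Suc n0)) < \<sigma> * \<epsilon>\<^sup>2 / 4"
        using reals_Archimedean[of "\<sigma> * \<epsilon>\<^sup>2 / 4"] \<epsilon> \<sigma> by auto
      have small: "J (w n) - d < \<sigma> * \<epsilon>\<^sup>2 / 4" if "n0 \<le> n" for n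
      proof -
        have "inverse (real (Suc n)) \<le> inverse (real (Suc n0))" using that by (simp add: field_simps)
        with w[of n] n0 show ?thesis by linarith
      qed
      have "dist (w m) (w n) < \<epsilon>" if "n0 \<le> m" "n0 \<le> n" for m n
      proof -
        have "2 * (J (w m) - d) + 2 * (J (w n) - d) < \<sigma> * \<epsilon>\<^sup>2"
          using add_strict_mono[OF small[OF that(1)] small[OF that(2)]] by (simp add: field_simps)
        with par[of "w m" "w n"] have "\<sigma> * (norm (w m - w n))\<^sup>2 < \<sigma> * \<epsilon>\<^sup>2"
          by (rule le_less_trans)
        with \<sigma> \<epsilon> show ?thesis
          by (auto simp: dist_norm intro: power_less_imp_less_base)
      qed
      then show "\<exists>M. \<forall>m\<ge>M. \<forall>n\<ge>M. dist (w m) (w n) < \<epsilon>" by blast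
    qed
    then obtain u where u: "w \<longlonglongrightarrow> u" using Cauchy_convergent convergent_def by blast
    have "(\<lambda>n. J (w n)) \<longlonglongrightarrow> J u"
      unfolding J_def by (intro tendsto_intros u)
    moreover have "(\<lambda>n. d + inverse (real (Suc n))) \<longlonglongrightarrow> d + 0"
      by (intro tendsto_intros LIMSEQ_inverse_real_of_nat)
    ultimately have "J u \<le> d + 0"
      by (rule LIMSEQ_le) (use w in \<open>auto intro: less_imp_le\<close>)
    then have minimal: "J u \<le> J v" for v using d_le[of v] by simp
    have "B u v = f v" for v
    proof -
      define p where "p = B u v - f v"
      define q where "q = B v v"
      have quad: "0 \<le> 2 * t * p + t\<^sup>2 * q" for t
        using minimal[of "u + t *\<^sub>R v"]
        by (simp add: J_def p_def q_def B_simps B_sym[of v u] algebra_simps power2_eq_square)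
      have q: "0 \<le> q"
        using coercive[of v] \<sigma> by (simp add: q_def) (smt (verit) mult_nonneg_nonneg zero_le_power2)
      \<comment> \<open>The step \<open>- p / (q + 1)\<close> makes the quadratic negative unless \<open>p = 0\<close>; the summand \<open>1\<close>
        covers the case \<open>q = 0\<close>.\<close>
      define a where "a = 1 / (q + 1)"
      have a: "0 < a" "a * (q + 1) = 1" using q by (simp_all add: a_def)
      have "2 * (- p * a) * p + (- p * a)\<^sup>2 * q = - (p\<^sup>2 * (a * (1 + a)))" using a(2) by algebra
      with quad[of "- p * a"] have "p\<^sup>2 * (a * (1 + a)) \<le> 0" by simp
      moreover have "0 < a * (1 + a)" using a(1) by simp
      ultimately have "p\<^sup>2 \<le> 0" by (metis mult_le_0_iff not_less)
      then have "p = 0" by simp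
      then show ?thesis by (simp add: p_def)
    qed
    then show ?thesis by (intro exI[of _ u] blinfun_eqI) simp
  qed
  ultimately show ?thesis by (auto simp: bij_def surj_def) metis
qed


section \<open>The estimate for the inverse operator\<close>

text \<open>
  The conclusions are the equalities of the coefficients of \<open>t\<^sup>2\<close> and \<open>t\<close> in
  \<open>(t - c) t\<^sup>2 - G (t - \<mu>)(t + s)\<^sup>2 = (t - \<alpha>)(t - \<beta>)((1 - G) t + \<delta>)\<close>. The other two coefficients
  agree at once, the constant one by the choice of \<open>\<delta>\<close>. So the difference of the two sides has the
  form \<open>t (p t + q)\<close>, and it vanishes because the left side \<open>F\<close> has the roots \<open>\<alpha>\<close> and \<open>\<beta>\<close>. In terms of
  the two-dimensional picture, \<open>r\<close> and \<open>\<kappa>\<close> are the squared tangents of vectors with Rayleigh quotients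
  \<open>\<mu>\<close> and \<open>c\<close>.
\<close>

lemma cubic_factorisation:
  fixes \<alpha> \<beta> \<mu> \<gamma> :: real
  assumes "0 < \<beta>" "\<beta> < \<mu>" "\<mu> \<le> \<alpha>" "0 < \<gamma>"
  defines "\<sigma> \<equiv> \<gamma> + (1 - \<gamma>) * \<beta> / \<alpha>"
  defines "r \<equiv> (\<alpha> - \<mu>) / (\<mu> - \<beta>)"
  defines "\<kappa> \<equiv> \<sigma>\<^sup>2 * r"
  defines "c \<equiv> (\<alpha> + \<kappa> * \<beta>) / (1 + \<kappa>)"
  defines "s \<equiv> \<beta> * (1 - \<gamma>) / \<gamma>"
  defines "G \<equiv> \<gamma>\<^sup>2 * (1 + r) / (1 + \<kappa>)"
  defines "\<delta> \<equiv> G * s\<^sup>2 * \<mu> / (\<alpha> * \<beta>)"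
  shows "- c - G * (2 * s - \<mu>) = - (\<alpha> + \<beta>) * (1 - G) + \<delta>"
    and "- G * (s\<^sup>2 - 2 * s * \<mu>) = \<alpha> * \<beta> * (1 - G) - (\<alpha> + \<beta>) * \<delta>"
proof -
  have \<alpha>\<beta>: "0 < \<alpha>" "\<beta> < \<alpha>" using assms(1-3) by auto
  have r: "0 \<le> r" using assms(2,3) by (simp add: r_def)
  have \<kappa>: "0 \<le> \<kappa>" using r by (simp add: \<kappa>_def)
  have r\<mu>: "(1 + r) * (\<mu> - \<beta>) = \<alpha> - \<beta>" "r * (\<mu> - \<beta>) = \<alpha> - \<mu>"
    using assms(2) by (simp_all add: r_def field_simps)
  have \<kappa>c: "(1 + \<kappa>) * (c - \<beta>) = \<alpha> - \<beta>" "(1 + \<kappa>) * (\<alpha> - c) = \<kappa> * (\<alpha> - \<beta>)"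
    using \<kappa> by (simp_all add: c_def field_simps)
  have \<kappa>G: "(1 + \<kappa>) * G = \<gamma>\<^sup>2 * (1 + r)"
    using \<kappa> by (simp add: G_def field_simps)
  have s\<beta>: "\<gamma> * (\<beta> + s) = \<beta>" using assms(4) by (simp add: s_def field_simps)
  have s\<alpha>: "\<gamma> * (\<alpha> + s) = \<sigma> * \<alpha>" using assms(4) \<alpha>\<beta> by (simp add: s_def \<sigma>_def field_simps)
  define F where "F t = (t - c) * t\<^sup>2 - G * (t - \<mu>) * (t + s)\<^sup>2" for t
  have "(1 + \<kappa>) * F \<beta> = - ((1 + \<kappa>) * (c - \<beta>)) * \<beta>\<^sup>2 + ((1 + \<kappa>) * G) * (\<mu> - \<beta>) * (\<beta> + s)\<^sup>2"
    unfolding F_def by algebra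
  also have "\<dots> = - (\<alpha> - \<beta>) * \<beta>\<^sup>2 + ((1 + r) * (\<mu> - \<beta>)) * (\<gamma> * (\<beta> + s))\<^sup>2"
    unfolding \<kappa>c \<kappa>G by algebra
  also have "\<dots> = 0" unfolding r\<mu> s\<beta> by algebra
  finally have F\<beta>: "F \<beta> = 0" using \<kappa> by simp
  have "(1 + \<kappa>) * F \<alpha> = ((1 + \<kappa>) * (\<alpha> - c)) * \<alpha>\<^sup>2 - ((1 + \<kappa>) * G) * (\<alpha> - \<mu>) * (\<alpha> + s)\<^sup>2"
    unfolding F_def by algebra
  also have "\<dots> = \<kappa> * (\<alpha> - \<beta>) * \<alpha>\<^sup>2 - (1 + r) * (r * (\<mu> - \<beta>)) * (\<gamma> * (\<alpha> + s))\<^sup>2"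
    unfolding \<kappa>c \<kappa>G r\<mu> by algebra
  also have "\<dots> = \<kappa> * (\<alpha> - \<beta>) * \<alpha>\<^sup>2 - ((1 + r) * (\<mu> - \<beta>)) * r * (\<sigma> * \<alpha>)\<^sup>2"
    unfolding s\<alpha> by algebra
  also have "\<dots> = 0" unfolding r\<mu> \<kappa>_def by algebra
  finally have F\<alpha>: "F \<alpha> = 0" using \<kappa> by simp
  have \<delta>: "\<alpha> * \<beta> * \<delta> = G * s\<^sup>2 * \<mu>" using \<alpha>\<beta> assms(1) by (simp add: \<delta>_def)
  define p where "p = (- c - G * (2 * s - \<mu>)) - (- (\<alpha> + \<beta>) * (1 - G) + \<delta>)"
  define q where "q = - G * (s\<^sup>2 - 2 * s * \<mu>) - (\<alpha> * \<beta> * (1 - G) - (\<alpha> + \<beta>) * \<delta>)"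
  have F: "F t - (t - \<alpha>) * (t - \<beta>) * ((1 - G) * t + \<delta>) = t * (p * t + q)" for t
    unfolding F_def p_def q_def using \<delta> by algebra
  have "p * \<alpha> + q = 0" "p * \<beta> + q = 0"
    using F[of \<alpha>] F[of \<beta>] F\<alpha> F\<beta> \<alpha>\<beta> assms(1) by simp_all
  then have "p * (\<alpha> - \<beta>) = 0" by algebra
  with \<alpha>\<beta> have "p = 0" by simp
  with \<open>p * \<alpha> + q = 0\<close> have "q = 0" by simp
  show "- c - G * (2 * s - \<mu>) = - (\<alpha> + \<beta>) * (1 - G) + \<delta>" using \<open>p = 0\<close> by (simp add: p_def)
  show "- G * (s\<^sup>2 - 2 * s * \<mu>) = \<alpha> * \<beta> * (1 - G) - (\<alpha> + \<beta>) * \<delta>" using \<open>q = 0\<close> by (simp add: q_def)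
qed

text \<open>
  Here \<open>e\<close> is the energy form and \<open>h\<close> the inner product of \<open>H\<close>, and \<open>T\<close> represents \<open>h\<close> in terms of \<open>e\<close>.
  The Rayleigh quotient of \<open>T\<close> at \<open>x\<close> is \<open>h x x / e x x\<close>.
\<close>

locale form_pencil = e: psd_form e + h: psd_form h
  for e h :: "'v::real_vector \<Rightarrow> 'v \<Rightarrow> real" +
  fixes T :: "'v \<Rightarrow> 'v"
  assumes T_linear: "linear T"
    and e_T: "e (T x) y = h x y"
begin

lemma T_simps: "T (x + y) = T x + T y" "T (x - y) = T x - T y" "T (t *\<^sub>R x) = t *\<^sub>R T x"
  using T_linear by (simp_all add: linear_add linear_diff linear_scale)

lemma e_T_right: "e x (T y) = h x y"
  using e_T[of y x] e.sym[of x "T y"] h.sym[of y x] by simp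

lemma h_T: "h (T x) y = e (T x) (T y)" "h x (T y) = e (T x) (T y)"
  using e_T_right[of "T x" y] e_T[of x "T y"] by simp_all

text \<open>
  The conclusion bounds the Rayleigh quotient of \<open>y\<close> from below by \<open>c\<close>, written without division so
  that it holds for every \<open>y\<close> in the ball. It comes from the cubic identity as follows. For
  \<open>x = (T + s) z\<close> every quantity in \<open>x\<close> is a combination of the moments \<open>m\<^sub>i = e (T\<^sup>i z) z\<close>, and the
  gap inequalities give \<open>m\<^sub>i\<^sub>+\<^sub>2 - (\<alpha> + \<beta>) m\<^sub>i\<^sub>+\<^sub>1 + \<alpha> \<beta> m\<^sub>i \<ge> 0\<close>. Weighted with the coefficients of
  \<open>((1 - G) t + \<delta>)(t + s)\<close>, which are nonnegative, they add up to the lower bound for the Lagrange function.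
\<close>

lemma ratio_contraction:
  assumes gap_e: "\<And>z. 0 \<le> e (T z) (T z) - (\<alpha> + \<beta>) * e (T z) z + \<alpha> * \<beta> * e z z"
    and gap_h: "\<And>z. 0 \<le> h (T z) (T z) - (\<alpha> + \<beta>) * h (T z) z + \<alpha> * \<beta> * h z z"
    and solvable: "\<And>s w. 0 < s \<Longrightarrow> \<exists>z. T z + s *\<^sub>R z = w"
    and "0 < \<beta>" "\<beta> < \<mu>" "\<mu> \<le> \<alpha>" "0 < \<gamma>" "\<gamma> < 1"
    and x: "h x x = \<mu> * e x x"
    and y: "e (y - T x) (y - T x) \<le> \<gamma>\<^sup>2 * e (T x - \<mu> *\<^sub>R x) (T x - \<mu> *\<^sub>R x)"
  shows "\<alpha> * e y y - h y y
    \<le> (\<gamma> + (1 - \<gamma>) * \<beta> / \<alpha>)\<^sup>2 * ((\<alpha> - \<mu>) / (\<mu> - \<beta>)) * (h y y - \<beta> * e y y)"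
proof -
  define \<sigma> where "\<sigma> = \<gamma> + (1 - \<gamma>) * \<beta> / \<alpha>"
  define r where "r = (\<alpha> - \<mu>) / (\<mu> - \<beta>)"
  define \<kappa> where "\<kappa> = \<sigma>\<^sup>2 * r"
  define c where "c = (\<alpha> + \<kappa> * \<beta>) / (1 + \<kappa>)"
  define s where "s = \<beta> * (1 - \<gamma>) / \<gamma>"
  define G where "G = \<gamma>\<^sup>2 * (1 + r) / (1 + \<kappa>)"
  define \<delta> where "\<delta> = G * s\<^sup>2 * \<mu> / (\<alpha> * \<beta>)"
  note defs = \<sigma>_def r_def \<kappa>_def c_def s_def G_def \<delta>_def
  note cubic = cubic_factorisation[OF \<open>0 < \<beta>\<close> \<open>\<beta> < \<mu>\<close> \<open>\<mu> \<le> \<alpha>\<close> \<open>0 < \<gamma>\<close>, folded defs, folded defs,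
      folded defs, folded defs]
  have \<alpha>: "0 < \<alpha>" "0 < \<mu>" using \<open>0 < \<beta>\<close> \<open>\<beta> < \<mu>\<close> \<open>\<mu> \<le> \<alpha>\<close> by auto
  have r: "0 \<le> r" using \<open>\<beta> < \<mu>\<close> \<open>\<mu> \<le> \<alpha>\<close> by (simp add: r_def)
  have \<kappa>: "0 \<le> \<kappa>" using r by (simp add: \<kappa>_def)
  have s: "0 < s" using \<open>0 < \<gamma>\<close> \<open>\<gamma> < 1\<close> \<open>0 < \<beta>\<close> by (simp add: s_def)
  have c: "0 < c" using \<kappa> \<alpha> \<open>0 < \<beta>\<close> by (simp add: c_def add_pos_nonneg)
  have \<gamma>\<sigma>: "\<gamma> \<le> \<sigma>" using \<open>\<gamma> < 1\<close> \<open>0 < \<beta>\<close> \<alpha> by (simp add: \<sigma>_def)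
  have G0: "0 \<le> G" using r \<kappa> by (simp add: G_def)
  have "\<gamma>\<^sup>2 \<le> 1" using \<open>0 < \<gamma>\<close> \<open>\<gamma> < 1\<close> by (simp add: power_le_one)
  moreover have "\<gamma>\<^sup>2 * r \<le> \<kappa>"
    unfolding \<kappa>_def using \<gamma>\<sigma> \<open>0 < \<gamma>\<close> r by (intro mult_right_mono power_mono) auto
  ultimately have G1: "G \<le> 1" using \<kappa> by (simp add: G_def field_simps)
  have \<gamma>G: "\<gamma>\<^sup>2 \<le> G"
  proof -
    have "\<sigma> \<le> \<gamma> + (1 - \<gamma>) * 1"
      unfolding \<sigma>_def times_divide_eq_right[symmetric]
      using \<open>\<gamma> < 1\<close> \<alpha> \<open>\<beta> < \<mu>\<close> \<open>\<mu> \<le> \<alpha>\<close> by (intro add_left_mono mult_left_mono) auto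
    then have "\<sigma>\<^sup>2 \<le> 1" using \<gamma>\<sigma> \<open>0 < \<gamma>\<close> by (simp add: power_le_one)
    then have "\<kappa> \<le> r" unfolding \<kappa>_def using r by (simp add: mult_left_le_one_le)
    then have "\<gamma>\<^sup>2 * (1 + \<kappa>) \<le> \<gamma>\<^sup>2 * (1 + r)" by (intro mult_left_mono) auto
    then show ?thesis using \<kappa> by (simp add: G_def pos_le_divide_eq)
  qed
  have \<delta>: "0 \<le> \<delta>" using G0 \<alpha> \<open>0 < \<beta>\<close> by (simp add: \<delta>_def)
  obtain z where z: "x = T z + s *\<^sub>R z" using solvable[OF s] by metis
  define m0 where "m0 = e z z"
  define m1 where "m1 = h z z"
  define m2 where "m2 = e (T z) (T z)"
  define m3 where "m3 = h (T z) (T z)"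
  define m4 where "m4 = e (T (T z)) (T (T z))"
  note moments = m0_def m1_def m2_def m3_def m4_def
  have gap0: "0 \<le> m2 - (\<alpha> + \<beta>) * m1 + \<alpha> * \<beta> * m0"
    using gap_e[of z] by (simp add: moments e_T)
  have gap1: "0 \<le> m3 - (\<alpha> + \<beta>) * m2 + \<alpha> * \<beta> * m1"
    using gap_h[of z] h_T(1)[of z z] by (simp add: moments)
  have gap2: "0 \<le> m4 - (\<alpha> + \<beta>) * m3 + \<alpha> * \<beta> * m2"
    using gap_e[of "T z"] e_T[of "T z" "T z"] h_T(1)[of z z] h_T(1)[of z "T z"] by (simp add: moments)
  define \<tau> where "\<tau> = s + c"
  have \<tau>: "0 < \<tau>" using s c by (simp add: \<tau>_def)
  define R where "R = e (T x - \<mu> *\<^sub>R x) (T x - \<mu> *\<^sub>R x)"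
  have e_moments: "e z z = m0" "e (T z) z = m1" "e z (T z) = m1" "e (T z) (T z) = m2"
    "e (T (T z)) z = m2" "e z (T (T z)) = m2" "e (T (T z)) (T z) = m3" "e (T z) (T (T z)) = m3"
    "e (T (T z)) (T (T z)) = m4"
    using e_T[of z z] e_T_right[of z z] e_T[of "T z" z] e_T_right[of z "T z"] h_T[of z z]
      e_T[of "T z" "T z"] e_T_right[of "T z" "T z"] by (simp_all only: moments)
  have h_moments: "h z z = m1" "h (T z) z = m2" "h z (T z) = m2" "h (T z) (T z) = m3"
    using h_T[of z z] by (simp_all only: moments)
  note simps = e.expand h.expand T_simps e_moments h_moments power2_eq_square algebra_simps
  \<comment> \<open>That \<open>\<mu>\<close> is the Rayleigh quotient of \<open>x\<close> is the relation \<open>((T - \<mu>) x, x) = 0\<close>, any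
    multiple of which may be added to the Lagrange function.\<close>
  have mean: "m3 + 2 * s * m2 + s\<^sup>2 * m1 = \<mu> * (m2 + 2 * s * m1 + s\<^sup>2 * m0)"
    using x unfolding z by (simp add: simps)
  have R: "R = m4 + 2 * (s - \<mu>) * m3 + ((s - \<mu>)\<^sup>2 - 2 * s * \<mu>) * m2
      - 2 * (s - \<mu>) * s * \<mu> * m1 + s\<^sup>2 * \<mu>\<^sup>2 * m0"
    unfolding R_def z by (simp add: simps)
  have TxTx: "e (T x) (T x) - \<tau> * e (T x) (T z) = m4 + (s - c) * m3 - s * c * m2"
    unfolding z \<tau>_def by (simp add: simps)
  have "0 \<le> (1 - G) * (m4 - (\<alpha> + \<beta>) * m3 + \<alpha> * \<beta> * m2)
      + ((1 - G) * s + \<delta>) * (m3 - (\<alpha> + \<beta>) * m2 + \<alpha> * \<beta> * m1)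
      + \<delta> * s * (m2 - (\<alpha> + \<beta>) * m1 + \<alpha> * \<beta> * m0)"
    using G1 \<delta> s by (intro add_nonneg_nonneg[OF add_nonneg_nonneg] mult_nonneg_nonneg gap0 gap1 gap2) auto
  also have "\<dots> = (m4 + (s - c) * m3 - s * c * m2) - G * R"
  proof -
    have "\<alpha> * \<beta> * \<delta> = G * s\<^sup>2 * \<mu>" using \<alpha> \<open>0 < \<beta>\<close> by (simp add: \<delta>_def)
    then show ?thesis using cubic mean unfolding R by algebra
  qed
  finally have key: "0 \<le> e (T x) (T x) - \<tau> * e (T x) (T z) - G * R" using TxTx by simp
  \<comment> \<open>The vector \<open>\<tau> T z = \<tau> (T + s)\<inverse> T x\<close> minimises the Lagrange function over \<open>y\<close>.\<close>
  define w where "w = y - \<tau> *\<^sub>R T z"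
  have "0 \<le> h w w + s * e w w" using s by (simp add: e.nonneg h.nonneg)
  also have "h w w + s * e w w
    = h y y + s * e y y - 2 * \<tau> * e y (T x) + \<tau>\<^sup>2 * e (T x) (T z)"
    unfolding w_def z
    by (simp add: simps e.sym[of "T z" y] h.sym[of "T z" y] e_T_right[of y "T z"])
  finally have square: "0 \<le> h y y + s * e y y - 2 * \<tau> * e y (T x) + \<tau>\<^sup>2 * e (T x) (T z)" .
  have "e (y - T x) (y - T x) \<le> G * R"
    using y mult_right_mono[OF \<gamma>G e.nonneg[of "T x - \<mu> *\<^sub>R x"]] by (simp add: R_def)
  moreover have "e (y - T x) (y - T x) = e y y - 2 * e y (T x) + e (T x) (T x)"
    using e.sym[of "T x" y] by (simp add: e.expand)
  ultimately have "\<tau> * (e y y - 2 * e y (T x) + e (T x) (T x)) \<le> \<tau> * (G * R)"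
    using \<tau> by simp
  moreover have "0 \<le> \<tau> * (e (T x) (T x) - \<tau> * e (T x) (T z) - G * R)"
    using key \<tau> by simp
  ultimately have "c * e y y \<le> h y y"
    using square by (simp add: \<tau>_def power2_eq_square algebra_simps)
  then have "(1 + \<kappa>) * (c * e y y) \<le> (1 + \<kappa>) * h y y" using \<kappa> by (intro mult_left_mono) auto
  moreover have "(1 + \<kappa>) * c = \<alpha> + \<kappa> * \<beta>" using \<kappa> by (simp add: c_def)
  then have "(1 + \<kappa>) * (c * e y y) = (\<alpha> + \<kappa> * \<beta>) * e y y" by (simp add: mult.assoc[symmetric])
  ultimately have "\<alpha> * e y y - h y y \<le> \<kappa> * (h y y - \<beta> * e y y)"
    by (simp add: algebra_simps)
  then show ?thesis unfolding \<kappa>_def \<sigma>_def r_def .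
qed

end


section \<open>The Gelfand triple\<close>

lemma E_op_apply: "E_op emb u w = inner (emb u) (emb w)"
  by (simp add: E_op_def inner_commute)

lemma bounded_linear_E_op: "bounded_linear (E_op emb)"
proof -
  have "bounded_linear (\<lambda>v. blinfun_inner_left (emb v) o\<^sub>L emb)"
    by (intro bounded_linear_compose[OF bounded_linear_blinfun_inner_left]
        bounded_bilinear.bounded_linear_left[OF bounded_bilinear_blinfun_compose, THEN bounded_linear_compose]
        blinfun.bounded_linear_right)
  then show ?thesis by (simp add: E_op_def[abs_def])
qed

lemma psd_form_of_strongly_positive:
  fixes A :: "'v::banach \<Rightarrow>\<^sub>L ('v \<Rightarrow>\<^sub>L real)"
  assumes "symmetric_op A" "strongly_positive A"
  shows "psd_form (\<lambda>u w. A u w)"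
proof
  show "bilinear (\<lambda>u w. A u w)"
    by (auto simp: bilinear_def blinfun.add_left blinfun.add_right blinfun.scaleR_left
        blinfun.scaleR_right intro!: linearI)
  show "A u w = A w u" for u w using assms(1) by (auto simp: symmetric_op_def)
  obtain \<sigma> where "0 < \<sigma>" "\<And>v. \<sigma> * (norm v)\<^sup>2 \<le> A v v"
    using assms(2) by (auto simp: strongly_positive_def)
  then show "0 \<le> A u u" for u by (meson mult_nonneg_nonneg less_imp_le order.trans zero_le_power2)
qed

lemma psd_form_inner:
  fixes emb :: "'v::banach \<Rightarrow>\<^sub>L 'h::{real_inner,complete_space}"
  shows "psd_form (\<lambda>u w. E_op emb u w)"
proof
  show "bilinear (\<lambda>u w. E_op emb u w)"
    by (auto simp: bilinear_def E_op_apply blinfun.add_right blinfun.scaleR_right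
        inner_add_left inner_add_right intro!: linearI)
qed (auto simp: E_op_apply inner_commute)

locale elliptic_pencil =
  fixes emb :: "'v::banach \<Rightarrow>\<^sub>L 'h::{real_inner,complete_space}"
    and A :: "'v \<Rightarrow>\<^sub>L ('v \<Rightarrow>\<^sub>L real)"
  assumes A_sym: "symmetric_op A" and A_pos: "strongly_positive A"
begin

text \<open>The solution operator \<open>A\<inverse> E\<close> of the source problem.\<close>

definition T :: "'v \<Rightarrow> 'v" where "T v = inv (blinfun_apply A) (E_op emb v)"

lemma bij_A: "bij (blinfun_apply A)"
  by (rule bij_of_strongly_positive[OF A_sym A_pos])

lemma A_eq_iff: "A u = A v \<longleftrightarrow> u = v"
  using bij_A by (auto simp: bij_def inj_def)

lemma A_T: "A (T v) = E_op emb v"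
  unfolding T_def using bij_A by (simp add: bij_is_surj surj_f_inv_f)

lemma inv_A: "inv (blinfun_apply A) (A v) = v"
  using bij_A by (simp add: bij_is_inj inv_f_f)

lemma T_eq_iff: "T v = u \<longleftrightarrow> A u = E_op emb v"
  using A_T[of v] A_eq_iff by metis

sublocale form_pencil "\<lambda>u w. A u w" "\<lambda>u w. E_op emb u w" T
proof (intro form_pencil.intro form_pencil_axioms.intro)
  show "psd_form (\<lambda>u w. A u w)" by (rule psd_form_of_strongly_positive[OF A_sym A_pos])
  show "psd_form (\<lambda>u w. E_op emb u w)" by (rule psd_form_inner)
  interpret E: bounded_linear "E_op emb" by (rule bounded_linear_E_op)
  show "linear T"
    by (intro linearI; subst T_eq_iff)
      (simp_all add: blinfun.add_right blinfun.scaleR_right A_T E.add E.scaleR)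
  show "A (T x) y = E_op emb x y" for x y by (simp add: A_T)
qed

lemma coercivity: "\<exists>\<sigma>>0. \<forall>v. \<sigma> * (norm v)\<^sup>2 \<le> A v v"
  using A_pos unfolding strongly_positive_def .

lemma A_bound: "A v v \<le> norm A * (norm v)\<^sup>2"
proof -
  have "A v v \<le> norm (A v) * norm v" using norm_blinfun[of "A v" v] by simp
  also have "\<dots> \<le> (norm A * norm v) * norm v"
    by (intro mult_right_mono norm_blinfun) simp
  finally show ?thesis by (simp add: power2_eq_square mult.assoc)
qed

lemma E_bound: "E_op emb v v \<le> (norm emb)\<^sup>2 * (norm v)\<^sup>2"
  unfolding E_op_apply power2_norm_eq_inner[symmetric] power_mult_distrib[symmetric]
  by (intro power_mono norm_blinfun) simp

lemma embedding_bound: "\<exists>K\<ge>0. \<forall>v. E_op emb v v \<le> K * A v v"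
proof -
  obtain \<sigma> where \<sigma>: "0 < \<sigma>" "\<And>v. \<sigma> * (norm v)\<^sup>2 \<le> A v v" using coercivity by blast
  have "E_op emb v v \<le> ((norm emb)\<^sup>2 / \<sigma>) * A v v" for v
  proof -
    have "(norm emb)\<^sup>2 / \<sigma> * (\<sigma> * (norm v)\<^sup>2) \<le> (norm emb)\<^sup>2 / \<sigma> * A v v"
      using \<sigma> by (intro mult_left_mono) auto
    then show ?thesis using E_bound[of v] \<sigma>(1) by simp
  qed
  moreover have "0 \<le> (norm emb)\<^sup>2 / \<sigma>" using \<sigma>(1) by simp
  ultimately show ?thesis by blast
qed

text \<open>Applying \<open>A\<close> turns \<open>T z + s z = w\<close> into the coercive equation \<open>E z + s A z = A w\<close>.\<close>

lemma shifted_solvable: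
  assumes "0 < s"
  shows "\<exists>z. T z + s *\<^sub>R z = w"
proof -
  define K where "K = Blinfun (\<lambda>v. E_op emb v + s *\<^sub>R A v)"
  have K: "K v = E_op emb v + s *\<^sub>R A v" for v
    unfolding K_def
    by (subst bounded_linear_Blinfun_apply)
      (auto intro!: bounded_linear_intros bounded_linear_E_op)
  obtain \<sigma> where \<sigma>: "0 < \<sigma>" "\<And>v. \<sigma> * (norm v)\<^sup>2 \<le> A v v" using coercivity by blast
  have "symmetric_op K"
    using e.sym h.sym by (auto simp: symmetric_op_def K blinfun.add_left blinfun.scaleR_left)
  moreover have "(s * \<sigma>) * (norm v)\<^sup>2 \<le> K v v" for v
  proof -
    have "s * (\<sigma> * (norm v)\<^sup>2) \<le> s * A v v" using \<sigma>(2)[of v] assms by (intro mult_left_mono) auto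
    also have "\<dots> \<le> K v v" using h.nonneg[of v] by (simp add: K blinfun.add_left blinfun.scaleR_left)
    finally show ?thesis by (simp only: mult.assoc)
  qed
  then have "strongly_positive K"
    unfolding strongly_positive_def using \<sigma>(1) assms by (intro exI[of _ "s * \<sigma>"]) auto
  ultimately have "bij (blinfun_apply K)" by (rule bij_of_strongly_positive)
  then obtain z where z: "K z = A w" by (metis bij_is_surj surjD)
  have "A (T z + s *\<^sub>R z) = A w"
    using z by (simp add: K A_T blinfun.add_right blinfun.scaleR_right)
  then show ?thesis using A_eq_iff by blast
qed

text \<open>
  The image \<open>T v\<close> solves \<open>A u - m\<inverse> E u = - m\<inverse> E w\<close> with \<open>w = T v - m v\<close>, whose right side lies in
  \<open>H*\<close> and is controlled by the norm of \<open>w\<close> in \<open>H\<close>. Estimating the \<open>V\<close>-norm by the \<open>H\<close>-norm lets one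
  bound serve for the energy form and for the inner product of \<open>H\<close>.
\<close>

lemma resolvent_estimate:
  assumes "0 < m" "inverse m \<in> resolvent_set emb A"
  obtains C where "0 \<le> C"
    "\<And>v. norm (T v) \<le> C * norm (emb (T v - m *\<^sub>R v))"
proof -
  define l where "l = inverse m"
  obtain R :: "('h \<Rightarrow>\<^sub>L real) \<Rightarrow>\<^sub>L 'v" where
    R: "\<And>f v. A v - l *\<^sub>R E_op emb v = f o\<^sub>L emb \<longleftrightarrow> v = R f"
    using assms(2) by (auto simp: resolvent_set_def l_def)
  interpret E: bounded_linear "E_op emb" by (rule bounded_linear_E_op)
  have "norm (T v) \<le> (norm R * l) * norm (emb (T v - m *\<^sub>R v))" for v
  proof -
    define w where "w = T v - m *\<^sub>R v"
    define f where "f = blinfun_inner_left (- l *\<^sub>R emb w)"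
    have "f o\<^sub>L emb = - l *\<^sub>R E_op emb w"
      by (rule blinfun_eqI) (simp add: f_def E_op_apply inner_commute blinfun.scaleR_left blinfun.minus_left)
    also have "\<dots> = A (T v) - l *\<^sub>R E_op emb (T v)"
      using assms(1) by (simp add: w_def E.diff E.scaleR A_T l_def algebra_simps)
    finally have "T v = R f" using R by metis
    also have "norm \<dots> \<le> norm R * norm f" by (rule norm_blinfun)
    finally have "norm (T v) \<le> norm R * norm f" .
    also have "norm R * norm f \<le> norm R * norm (- l *\<^sub>R emb w)"
      unfolding f_def
    proof (intro mult_left_mono norm_blinfun_bound)
      show "norm (blinfun_inner_left (- l *\<^sub>R emb w) x) \<le> norm (- l *\<^sub>R emb w) * norm x" for x
        using Cauchy_Schwarz_ineq2[of x "- l *\<^sub>R emb w"]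
        by (simp add: mult.commute del: inner_scaleR_right norm_scaleR)
    qed simp_all
    also have "\<dots> = norm R * (l * norm (emb w))" using assms(1) by (simp add: l_def)
    finally show ?thesis by (simp add: w_def mult.assoc)
  qed
  moreover have "0 \<le> norm R * l" using assms(1) by (simp add: l_def)
  ultimately show ?thesis using that by blast
qed


text \<open>
  For every form \<open>g\<close> between the norm of \<open>H\<close> and that of \<open>V\<close>, the operator \<open>T - m\<close> is bounded below: write
  \<open>m v = T v - w\<close> and estimate \<open>T v\<close> by \<open>w\<close>.
\<close>

lemma gap_nonneg_of_resolvent:
  assumes "psd_form g"
    and T_sym: "\<And>x y. g (T x) y = g x (T y)"
    and T_bound: "\<And>x. g (T x) (T x) \<le> M * g x x"
    and g_bound: "0 \<le> C1" "\<And>x. g x x \<le> C1 * (norm x)\<^sup>2"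
    and h_bound: "0 \<le> C2" "\<And>x. E_op emb x x \<le> C2 * g x x"
    and "0 < b" "b < a"
    and resolvent: "\<And>m. b < m \<Longrightarrow> m < a \<Longrightarrow> inverse m \<in> resolvent_set emb A"
  shows "0 \<le> g (T x) (T x) - (a + b) * g (T x) x + a * b * g x x"
proof -
  interpret g: psd_form g by fact
  show ?thesis
  proof (rule g.gap_nonneg[OF T_linear T_sym T_bound _ \<open>b < a\<close>])
    fix m assume m: "b < m" "m < a"
    with \<open>0 < b\<close> have m_pos: "0 < m" by simp
    obtain C where C: "0 \<le> C" "\<And>v. norm (T v) \<le> C * norm (emb (T v - m *\<^sub>R v))"
      using resolvent_estimate[OF m_pos resolvent[OF m]] by blast
    define L where "L = 2 * (C1 * C\<^sup>2 * C2) + 2"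
    have L: "0 < L" using g_bound(1) h_bound(1) by (simp add: L_def add_nonneg_pos)
    have "m\<^sup>2 / L * g v v \<le> g (T v - m *\<^sub>R v) (T v - m *\<^sub>R v)" for v
    proof -
      define w where "w = T v - m *\<^sub>R v"
      have "g (T v) (T v) \<le> C1 * (norm (T v))\<^sup>2" by (rule g_bound)
      also have "\<dots> \<le> C1 * (C * norm (emb w))\<^sup>2"
        unfolding w_def by (intro mult_left_mono power_mono C g_bound) simp
      also have "\<dots> = (C1 * C\<^sup>2) * E_op emb w w"
        by (simp add: E_op_apply power_mult_distrib power2_norm_eq_inner)
      also have "\<dots> \<le> (C1 * C\<^sup>2) * (C2 * g w w)"
        using g_bound(1) by (intro mult_left_mono h_bound) simp
      finally have Tv: "g (T v) (T v) \<le> C1 * C\<^sup>2 * C2 * g w w" by (simp add: mult.assoc)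
      have "m\<^sup>2 * g v v = g (T v - w) (T v - w)"
        by (simp add: w_def g.expand power2_eq_square)
      also have "\<dots> \<le> 2 * g (T v) (T v) + 2 * g w w"
        using g.nonneg[of "T v + w"] by (simp add: g.expand)
      also have "\<dots> \<le> L * g w w" using Tv by (simp add: L_def algebra_simps)
      finally show ?thesis using L by (simp add: w_def field_simps)
    qed
    moreover have "0 < m\<^sup>2 / L" using m_pos L by simp
    ultimately show "\<exists>d>0. \<forall>x. d * g x x \<le> g (T x - m *\<^sub>R x) (T x - m *\<^sub>R x)" by blast
  qed
qed

text \<open>
  Boundedness of \<open>T\<close> in both forms comes from Cauchy-Schwarz in \<open>H\<close> for \<open>e (T x) (T x) = h x (T x)\<close>,
  combined with the continuity of the embedding.
\<close>

lemma spectral_gap: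
  assumes "0 < b" "b < a"
    and resolvent: "\<And>m. b < m \<Longrightarrow> m < a \<Longrightarrow> inverse m \<in> resolvent_set emb A"
  shows "0 \<le> A (T x) (T x) - (a + b) * A (T x) x + a * b * A x x" (is ?energy)
    and "0 \<le> E_op emb (T x) (T x) - (a + b) * E_op emb (T x) x + a * b * E_op emb x x" (is ?inner)
proof -
  obtain K where K: "0 \<le> K" "\<And>v. E_op emb v v \<le> K * A v v" using embedding_bound by blast
  have cancel: "X \<le> M * Y" if "X\<^sup>2 \<le> M * Y * X" "0 \<le> X" "0 \<le> M" "0 \<le> Y" for X Y M :: real
    using that by (cases "X = 0") (auto simp: power2_eq_square)
  have T_A: "A (T x) (T x) \<le> K\<^sup>2 * A x x" for x
  proof (rule cancel)
    have "(A (T x) (T x))\<^sup>2 \<le> E_op emb x x * E_op emb (T x) (T x)"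
      using h.cauchy_schwarz[of x "T x"] by (simp add: A_T)
    also have "\<dots> \<le> (K * A x x) * (K * A (T x) (T x))"
      using K e.nonneg h.nonneg by (intro mult_mono) auto
    finally show "(A (T x) (T x))\<^sup>2 \<le> K\<^sup>2 * A x x * A (T x) (T x)"
      by (simp add: power2_eq_square mult_ac)
  qed (simp_all add: e.nonneg)
  have T_E: "E_op emb (T x) (T x) \<le> K\<^sup>2 * E_op emb x x" for x
  proof (rule cancel)
    have "E_op emb (T x) (T x) \<le> K * E_op emb x (T x)" using K(2)[of "T x"] by (simp add: A_T)
    then have "(E_op emb (T x) (T x))\<^sup>2 \<le> (K * E_op emb x (T x))\<^sup>2"
      using h.nonneg by (intro power_mono)
    also have "\<dots> \<le> K\<^sup>2 * (E_op emb x x * E_op emb (T x) (T x))"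
      unfolding power_mult_distrib by (intro mult_left_mono h.cauchy_schwarz) simp
    finally show "(E_op emb (T x) (T x))\<^sup>2 \<le> K\<^sup>2 * E_op emb x x * E_op emb (T x) (T x)"
      by (simp add: mult_ac)
  qed (simp_all add: h.nonneg)
  show ?energy
    by (rule gap_nonneg_of_resolvent[OF e.psd_form_axioms _ T_A _ A_bound K assms])
      (use e_T e_T_right in auto)
  show ?inner
    by (rule gap_nonneg_of_resolvent[where ?C2.0 = 1, OF h.psd_form_axioms _ T_E _ E_bound _ _ assms])
      (use h_T in auto)
qed

text \<open>
  A supremum of reals bounds its members only if they are bounded above; that the quotients are
  follows from the spectral equivalence. At \<open>u = 0\<close>, where the quotient has the default value \<open>0\<close>,
  the estimate needs that \<open>P\<inverse>\<close> maps \<open>0\<close> to \<open>0\<close>, which the coercivity of \<open>P\<close> gives.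
\<close>

lemma preconditioner_error:
  assumes "symmetric_op P" "spectrally_equivalent P A"
  defines "r \<equiv> op_norm_A A (\<lambda>u. u - inv (blinfun_apply P) (A u))"
  shows "0 \<le> r" and "norm_A A (u - inv (blinfun_apply P) (A u)) \<le> r * norm_A A u"
proof -
  define S where "S u = inv (blinfun_apply P) (A u)" for u
  define Q where "Q u = norm_A A (u - S u) / norm_A A u" for u
  obtain c where c: "0 < c" "\<And>v. c * A v v \<le> P v v"
    using assms(2) by (auto simp: spectrally_equivalent_def)
  obtain \<sigma> where \<sigma>: "0 < \<sigma>" "\<And>v. \<sigma> * (norm v)\<^sup>2 \<le> A v v" using coercivity by blast
  have "(c * \<sigma>) * (norm v)\<^sup>2 \<le> P v v" for v
  proof -
    have "c * (\<sigma> * (norm v)\<^sup>2) \<le> c * A v v" using \<sigma>(2)[of v] c(1) by (intro mult_left_mono) auto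
    with c(2)[of v] show ?thesis by (simp only: mult.assoc)
  qed
  then have "strongly_positive P"
    unfolding strongly_positive_def using \<sigma>(1) c(1) by (intro exI[of _ "c * \<sigma>"]) auto
  then have "bij (blinfun_apply P)" by (rule bij_of_strongly_positive[OF assms(1)])
  then have P_S: "P (S u) = A u" for u by (simp add: S_def bij_is_surj surj_f_inv_f)
  have norm_pos: "0 < norm_A A u" if "u \<noteq> 0" for u
  proof -
    have "0 < \<sigma> * (norm u)\<^sup>2" using \<sigma>(1) that by simp
    with \<sigma>(2)[of u] show ?thesis by (simp add: norm_A_def)
  qed
  have S_bound: "norm_A A (S u) \<le> norm_A A u / c" for u
  proof -
    have "(c * A (S u) (S u))\<^sup>2 \<le> (A u (S u))\<^sup>2"
      using c(2)[of "S u"] c(1) e.nonneg[of "S u"] by (intro power_mono) (simp_all add: P_S)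
    also have "\<dots> \<le> A u u * A (S u) (S u)" by (rule e.cauchy_schwarz)
    finally have "c\<^sup>2 * A (S u) (S u) * A (S u) (S u) \<le> A u u * A (S u) (S u)"
      by (simp add: power2_eq_square mult_ac)
    then have "c\<^sup>2 * A (S u) (S u) \<le> A u u"
      using e.nonneg[of "S u"] e.nonneg[of u] by (cases "A (S u) (S u) = 0") auto
    then have "sqrt (c\<^sup>2 * A (S u) (S u)) \<le> sqrt (A u u)" by simp
    then show ?thesis using c(1) by (simp add: norm_A_def real_sqrt_mult field_simps)
  qed
  have Q_bound: "Q u \<le> 1 + 1 / c" for u
  proof (cases "u = 0")
    case True
    then show ?thesis using c(1) by (simp add: Q_def norm_A_def)
  next
    case False
    have "norm_A A (u - S u) \<le> norm_A A u + norm_A A (- S u)"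
      using e.triangle[of u "- S u"] by (simp add: norm_A_def)
    also have "norm_A A (- S u) = norm_A A (S u)" by (simp add: norm_A_def e.expand)
    also have "\<dots> \<le> norm_A A u / c" by (rule S_bound)
    finally show ?thesis using norm_pos[OF False] c(1) by (simp add: Q_def field_simps)
  qed
  have r: "r = (SUP u. Q u)" by (simp add: r_def op_norm_A_def Q_def S_def)
  have Q_r: "Q u \<le> r" for u
    unfolding r by (rule cSUP_upper[OF UNIV_I bdd_aboveI2]) (rule Q_bound)
  show "0 \<le> r" using Q_r[of 0] by (simp add: Q_def norm_A_def)
  show "norm_A A (u - inv (blinfun_apply P) (A u)) \<le> r * norm_A A u"
  proof (cases "u = 0")
    case True
    have "P (S 0) = 0" by (simp add: P_S)
    with c(2)[of "S 0"] c(1) e.nonneg[of "S 0"] have "A (S 0) (S 0) = 0"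
      by (simp add: mult_le_0_iff)
    with True show ?thesis by (simp add: norm_A_def S_def e.expand)
  next
    case False
    then show ?thesis using Q_r[of u] norm_pos[OF False] by (simp add: Q_def S_def field_simps)
  qed
qed

lemma rayleigh_scaleR: "t \<noteq> 0 \<Longrightarrow> rayleigh emb A (t *\<^sub>R v) = rayleigh emb A v"
  by (simp add: rayleigh_def e.expand h.expand)

lemma residual_eq:
  "residual emb A v
    = norm_A A (v - rayleigh emb A v *\<^sub>R T v) / norm_A A v"
proof -
  have "A v - rayleigh emb A v *\<^sub>R E_op emb v = A (v - rayleigh emb A v *\<^sub>R T v)"
    by (simp add: blinfun.diff_right blinfun.scaleR_right A_T)
  then show ?thesis by (simp only: residual_def norm_Ainv_def norm_A_def inv_A)
qed

text \<open>
  With \<open>d = v - l T v\<close> the residual functional is \<open>A d\<close>, so that the new iterate differs from \<open>l T v\<close>, the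
  result of exact inverse iteration, by \<open>(Id - P\<inverse> A) d + \<xi>\<close>.
\<close>

lemma pinvit_update_distance:
  assumes "symmetric_op P" "spectrally_equivalent P A"
    and "op_norm_A A (\<lambda>u. u - inv (blinfun_apply P) (A u)) \<le> \<gamma>\<^sub>P"
    and "v \<noteq> 0" "norm_A A \<xi> / norm_A A v \<le> \<gamma>\<^sub>\<xi> * residual emb A v"
  defines "l \<equiv> rayleigh emb A v"
  shows "norm_A A (pinvit_update emb A P \<xi> v - l *\<^sub>R T v) \<le> (\<gamma>\<^sub>P + \<gamma>\<^sub>\<xi>) * norm_A A (v - l *\<^sub>R T v)"
proof -
  define d where "d = v - l *\<^sub>R T v"
  obtain \<sigma> where \<sigma>: "0 < \<sigma>" "\<And>v. \<sigma> * (norm v)\<^sup>2 \<le> A v v" using coercivity by blast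
  have "0 < \<sigma> * (norm v)\<^sup>2" using \<sigma>(1) assms(4) by simp
  with \<sigma>(2)[of v] have pos: "0 < norm_A A v" by (simp add: norm_A_def)
  have d0: "0 \<le> norm_A A d" by (simp add: norm_A_def e.nonneg)
  have Ad: "A v - l *\<^sub>R E_op emb v = A d"
    by (simp add: d_def blinfun.diff_right blinfun.scaleR_right A_T)
  have "pinvit_update emb A P \<xi> v - l *\<^sub>R T v = (d - inv (blinfun_apply P) (A d)) + \<xi>"
    by (simp add: pinvit_update_def l_def[symmetric] Ad) (simp add: d_def)
  then have "norm_A A (pinvit_update emb A P \<xi> v - l *\<^sub>R T v)
      \<le> norm_A A (d - inv (blinfun_apply P) (A d)) + norm_A A \<xi>"
    using e.triangle by (simp add: norm_A_def)
  also have "\<dots> \<le> \<gamma>\<^sub>P * norm_A A d + \<gamma>\<^sub>\<xi> * norm_A A d"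
  proof (rule add_mono)
    show "norm_A A (d - inv (blinfun_apply P) (A d)) \<le> \<gamma>\<^sub>P * norm_A A d"
      using preconditioner_error(2)[OF assms(1,2), of d] mult_right_mono[OF assms(3) d0] by simp
    show "norm_A A \<xi> \<le> \<gamma>\<^sub>\<xi> * norm_A A d"
      using assms(5) pos by (simp add: residual_eq l_def[symmetric] d_def[symmetric] divide_le_cancel)
  qed
  finally show ?thesis by (simp add: d_def algebra_simps)
qed

end

lemma gap_in_resolvent_set:
  assumes "discrete_lower_spectrum emb A N lam \<Lambda>"
    and "1 \<le> k" "k \<le> N - 1" "lam k < x" "x < lam (k + 1)"
  shows "x \<in> resolvent_set emb A"
proof (rule ccontr)
  have N: "1 \<le> N" "strict_mono_on {1..N} lam" "lam N < \<Lambda>"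
    and rest: "\<forall>\<mu>\<in>op_spectrum emb A - lam ` {1..N}. \<Lambda> \<le> \<mu>"
    using assms(1) by (auto simp: discrete_lower_spectrum_def)
  have mono: "mono_on {1..N} lam" by (rule strict_mono_on_imp_mono_on[OF N(2)])
  assume "x \<notin> resolvent_set emb A"
  then have "x \<in> op_spectrum emb A" by (simp add: op_spectrum_def)
  moreover have "x \<noteq> lam j" if "j \<in> {1..N}" for j
  proof (cases "j \<le> k")
    case True
    then have "lam j \<le> lam k" using that assms(2,3) by (intro mono_onD[OF mono]) auto
    with assms(4) show ?thesis by simp
  next
    case False
    then have "lam (k + 1) \<le> lam j" using that assms(2,3) by (intro mono_onD[OF mono]) auto
    with assms(5) show ?thesis by simp
  qed
  ultimately have "\<Lambda> \<le> x" using rest by (metis DiffI imageE)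
  moreover have "lam (k + 1) \<le> lam N"
    using assms(2,3) N(1) by (intro mono_onD[OF mono]) auto
  ultimately show False using assms(5) N(3) by simp
qed

theorem theorem3:
  fixes emb :: "'v::banach \<Rightarrow>\<^sub>L 'h::{real_inner,complete_space}"
    and A P :: "'v \<Rightarrow>\<^sub>L ('v \<Rightarrow>\<^sub>L real)"
    and N k :: nat
    and lam :: "nat \<Rightarrow> real"
    and \<Lambda> \<gamma>\<^sub>P \<gamma>\<^sub>\<xi> \<gamma> l l' :: real
    and v \<xi> v' :: 'v
  assumes "gelfand_triple emb"
    and "symmetric_op A" and "strongly_positive A"
    and "discrete_lower_spectrum emb A N lam \<Lambda>"
    and "symmetric_op P" and "spectrally_equivalent P A"
    and "op_norm_A A (\<lambda>u. u - inv (blinfun_apply P) (A u)) \<le> \<gamma>\<^sub>P" and "\<gamma>\<^sub>P < 1"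
    and "0 \<le> \<gamma>\<^sub>\<xi>" and "\<gamma> = \<gamma>\<^sub>P + \<gamma>\<^sub>\<xi>" and "\<gamma> < 1"
    and "1 \<le> k" and "k \<le> N - 1"
    and "v \<noteq> 0" and "l = rayleigh emb A v"
    and "lam k \<le> l" and "l < lam (k + 1)"
    and "norm_A A \<xi> / norm_A A v \<le> \<gamma>\<^sub>\<xi> * residual emb A v"
    and "v' = pinvit_step emb A P \<xi> v" and "l' = rayleigh emb A v'"
  shows "l' < lam k \<or>
    (lam k \<le> l' \<and> l' < lam (k + 1) \<and>
     (l' - lam k) / (lam (k + 1) - l')
       \<le> (conv_factor \<gamma> (lam k) (lam (k + 1)))\<^sup>2 * ((l - lam k) / (lam (k + 1) - l)))"
proof (cases "l' < lam k")
  case False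
  interpret elliptic_pencil emb A by unfold_locales (rule assms)+
  define p where "p = lam k"
  define q where "q = lam (k + 1)"
  have lam: "0 < lam 1" "strict_mono_on {1..N} lam"
    using assms(4) by (auto simp: discrete_lower_spectrum_def)
  have "mono_on {1..N} lam" by (rule strict_mono_on_imp_mono_on[OF lam(2)])
  then have "lam 1 \<le> p" unfolding p_def by (rule mono_onD) (use assms(12,13) in auto)
  with lam(1) have p: "0 < p" by simp
  have pl: "p \<le> l" "l < q" "p \<le> l'" using assms(16,17) False by (auto simp: p_def q_def)
  with p have pos: "0 < q" "0 < l" "0 < l'" "p < q" by auto
  have gap: "inverse m \<in> resolvent_set emb A" if "1 / q < m" "m < 1 / p" for m
  proof -
    have "0 < m" using that(1) pos(1) by (meson less_trans zero_less_divide_1_iff)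
    then show ?thesis
      using that p pos(1) unfolding p_def q_def by (intro gap_in_resolvent_set[OF assms(4,12,13)])
        (simp_all add: field_simps)
  qed
  have pq: "0 < 1 / q" "1 / q < 1 / p" "1 / q < 1 / l" "1 / l \<le> 1 / p"
    using p pl pos by (auto simp: field_simps)
  have "0 \<le> \<gamma>\<^sub>P"
    using preconditioner_error(1)[OF assms(5,6)] assms(7) by simp
  with assms(9,10) have \<gamma>: "0 \<le> \<gamma>" by simp
  have x: "E_op emb v v = 1 / l * A v v"
    using pos(2) assms(15) by (auto simp: rayleigh_def field_simps)
  define w where "w = pinvit_update emb A P \<xi> v"
  \<comment> \<open>Rescaled, so that the ball is centred at \<open>T v\<close>.\<close>
  define y where "y = (1 / l) *\<^sub>R w"
  have dist: "A (y - T v) (y - T v) \<le> \<gamma>\<^sup>2 * A (T v - (1 / l) *\<^sub>R v) (T v - (1 / l) *\<^sub>R v)"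
  proof -
    have "norm_A A (w - l *\<^sub>R T v) \<le> \<gamma> * norm_A A (v - l *\<^sub>R T v)"
      unfolding w_def assms(10,15)
      by (rule pinvit_update_distance[OF assms(5,6,7,14,18)])
    then have "(norm_A A (w - l *\<^sub>R T v))\<^sup>2 \<le> (\<gamma> * norm_A A (v - l *\<^sub>R T v))\<^sup>2"
      by (rule power_mono) (simp add: norm_A_def e.nonneg)
    then have "A (w - l *\<^sub>R T v) (w - l *\<^sub>R T v) \<le> \<gamma>\<^sup>2 * A (v - l *\<^sub>R T v) (v - l *\<^sub>R T v)"
      by (simp add: norm_A_def e.nonneg power_mult_distrib)
    moreover have scale: "A (t *\<^sub>R d) (t *\<^sub>R d) = t\<^sup>2 * A d d" for t d
      by (simp add: e.expand power2_eq_square)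
    have "w - l *\<^sub>R T v = l *\<^sub>R (y - T v)"
      "v - l *\<^sub>R T v = - l *\<^sub>R (T v - (1 / l) *\<^sub>R v)"
      using pos(2) by (simp_all add: y_def algebra_simps)
    then have "A (w - l *\<^sub>R T v) (w - l *\<^sub>R T v) = l\<^sup>2 * A (y - T v) (y - T v)"
      "A (v - l *\<^sub>R T v) (v - l *\<^sub>R T v) = l\<^sup>2 * A (T v - (1 / l) *\<^sub>R v) (T v - (1 / l) *\<^sub>R v)"
      by (simp_all only: scale power2_minus)
    ultimately have "l\<^sup>2 * A (y - T v) (y - T v)
        \<le> l\<^sup>2 * (\<gamma>\<^sup>2 * A (T v - (1 / l) *\<^sub>R v) (T v - (1 / l) *\<^sub>R v))"
      by (simp only: mult.left_commute)
    then show ?thesis using pos(2) by simp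
  qed
  define \<sigma> where "\<sigma> g = g + (1 - g) * (1 / q) / (1 / p)" for g
  have \<sigma>: "\<sigma> g = conv_factor g p q" for g
    by (simp add: \<sigma>_def conv_factor_def algebra_simps)
  define X where "X = 1 / p * A y y - E_op emb y y"
  define Y where "Y = (1 / p - 1 / l) / (1 / l - 1 / q) * (E_op emb y y - 1 / q * A y y)"
  have step: "X \<le> (\<sigma> g)\<^sup>2 * Y" if g: "\<gamma> < g" "g < 1" for g
  proof -
    have "A (y - T v) (y - T v) \<le> g\<^sup>2 * A (T v - (1 / l) *\<^sub>R v) (T v - (1 / l) *\<^sub>R v)"
      using \<gamma> g by (intro order.trans[OF dist] mult_right_mono power_mono e.nonneg) auto
    then show ?thesis
      unfolding X_def Y_def \<sigma>_def mult.assoc[symmetric]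
      using ratio_contraction[OF spectral_gap(1)[OF pq(1,2) gap] spectral_gap(2)[OF pq(1,2) gap]
          shifted_solvable pq(1,3,4) _ g(2) x] \<gamma> g by simp
  qed
  \<comment> \<open>The contraction estimate requires a positive parameter. For \<open>\<gamma> = 0\<close> it holds with each larger
    parameter and passes to the limit.\<close>
  have "((\<lambda>g. (\<sigma> g)\<^sup>2 * Y) \<longlongrightarrow> (\<sigma> \<gamma>)\<^sup>2 * Y) (at_right \<gamma>)"
    unfolding \<sigma> conv_factor_def by (intro tendsto_intros)
  moreover have "\<forall>\<^sub>F g in at_right \<gamma>. X \<le> (\<sigma> g)\<^sup>2 * Y"
    unfolding eventually_at_right_field using step assms(11) by blast
  ultimately have XY: "X \<le> (\<sigma> \<gamma>)\<^sup>2 * Y"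
    by (rule tendsto_lowerbound) simp
  have l'_y: "l' = A y y / E_op emb y y"
  proof -
    \<comment> \<open>If \<open>emb w\<close> were zero, then \<open>v'\<close> would be zero as well, with the Rayleigh quotient \<open>0 / 0 = 0\<close>,
      although \<open>l' \<ge> p > 0\<close>.\<close>
    have "emb w \<noteq> 0"
      using pos(3) unfolding assms(19,20) pinvit_step_def w_def[symmetric] Let_def
      by (auto simp: rayleigh_def)
    then have "rayleigh emb A v' = rayleigh emb A w"
      unfolding assms(19) pinvit_step_def w_def[symmetric] Let_def by (simp add: rayleigh_scaleR)
    also have "\<dots> = rayleigh emb A y" unfolding y_def using pos(2) by (simp add: rayleigh_scaleR)
    finally show ?thesis by (simp add: assms(20) rayleigh_def)
  qed
  then have "E_op emb y y \<noteq> 0" using pos(3) by auto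
  with h.nonneg[of y] have h_pos: "0 < E_op emb y y" by simp
  with l'_y have A_y: "A y y = l' * E_op emb y y" by (simp add: field_simps)
  define t where "t = (conv_factor \<gamma> p q)\<^sup>2 * ((l - p) / (q - l))"
  have t: "0 \<le> t" using pl by (simp add: t_def)
  have "X = (l' - p) * (E_op emb y y / p)" using p by (simp add: X_def A_y field_simps)
  moreover have "(\<sigma> \<gamma>)\<^sup>2 * Y = t * (q - l') * (E_op emb y y / p)"
  proof -
    have "(1 / p - 1 / l) / (1 / l - 1 / q) = q / p * ((l - p) / (q - l))"
      using p pl pos by (simp add: field_simps)
    moreover have "E_op emb y y - 1 / q * A y y = (q - l') * E_op emb y y / q"
      using pos(1) by (simp add: A_y field_simps)
    ultimately show ?thesis using pos(1) by (simp add: Y_def \<sigma> t_def mult_ac)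
  qed
  ultimately have bound: "l' - p \<le> t * (q - l')"
    using XY h_pos p by (simp add: mult_le_cancel_right divide_le_cancel)
  have "l' < q"
  proof (rule ccontr)
    assume "\<not> l' < q"
    then have "t * (q - l') \<le> 0" using t by (simp add: mult_nonneg_nonpos)
    with bound \<open>\<not> l' < q\<close> pos(4) show False by simp
  qed
  moreover from this bound have "(l' - p) / (q - l') \<le> t" by (simp add: pos_divide_le_eq)
  ultimately show ?thesis using pl(3) by (simp add: t_def p_def q_def)
qed simp

end
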